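(* Let $\{y^t\}_{t\ge0}$ be the dual iterates of the randomized gossip algorithm with uniform edge-selection probabilities $p_e=1/m$, $e\in\mathcal E$. Then for all $k\ge0$ $$\mathbb{E}\left[D(y^* )-D(y^k)\right]\le\left(1-\frac{\alpha(\mathcal G)}{2m}\right)^k\left[D(y^* )-D(y^0)\right].$$
   Context: $\mathcal G=(\mathcal V,\mathcal E)$ is an undirected connected (simple) graph with $\mathcal V=\{1,\dots,n\}$, $n\ge2$, $|\mathcal E|=m$. Each edge is written $e=(i,j)$ with a fixed orientation. $\mathbf A\in\mathbb{R}^{m\times n}$ is the incidence matrix: row $e=(i,j)$ has $\mathbf A_{ei}=1$, $\mathbf A_{ej}=-1$ and all other entries $0$; $f_e\in\mathbb{R}^m$ is the unit basis vector indexed by $e$. $\alpha(\mathcal G)$ (algebraic connectivity) is the second smallest eigenvalue of $\mathbf A^\top\mathbf A$. $c\in\mathbb{R}^n$ is the vector of initial values, $D(y)=-(\mathbf A c)^\top y-\frac12\|\mathbf A^\top y\|^2$, and $y^*$ is a maximizer of $D$ over $\mathbb{R}^m$. Randomized gossip algorithm (dual form): $y^0=0\in\mathbb{R}^m$; in each iteration $t=0,1,\dots$ choose an edge $e=(i,j)\in\mathcal E$ uniformly at random (independently of the past) and set $y^{t+1}=y^t+\lambda^t f_e$ with $\lambda^t=\operatorname{argmax}_{\lambda'\in\mathbb{R}}D(y^t+\lambda'f_e)$. (Equivalently, for $x^t=c+\mathbf A^\top y^t$, both $x_i$ and $x_j$ are replaced by $(x^t_i+x^t_j)/2$ and the other coordinates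 are unchanged.) *)

theory Defs
  imports
    "HOL-Analysis.Analysis"
    "HOL-Probability.Probability"
    "HOL-Computational_Algebra.Polynomial"
begin

text \<open>
  An undirected simple graph has all elements of the finite type \<open>'v\<close> as vertices and is
  given by its set \<open>E\<close> of two-element edges.
\<close>

definition simple_graph :: "'v set set \<Rightarrow> bool" where
  "simple_graph E \<longleftrightarrow> (\<forall>e\<in>E. card e = 2)"

definition connected_graph :: "'v set set \<Rightarrow> bool" where
  "connected_graph E \<longleftrightarrow> (\<forall>u v. (u, v) \<in> {(a, b). {a, b} \<in> E}\<^sup>*)"

text \<open>
  The type \<open>'e\<close> indexes the edges bijectively (so \<open>card E = CARD('e)\<close>), the edge with index \<open>e\<close>
  being oriented from \<open>src e\<close> to \<open>tgt e\<close>.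
\<close>

definition edge_orientation :: "'v set set \<Rightarrow> ('e \<Rightarrow> 'v) \<Rightarrow> ('e \<Rightarrow> 'v) \<Rightarrow> bool" where
  "edge_orientation E src tgt \<longleftrightarrow> bij_betw (\<lambda>e. {src e, tgt e}) UNIV E"

definition incidence_matrix :: "('e::finite \<Rightarrow> 'v::finite) \<Rightarrow> ('e \<Rightarrow> 'v) \<Rightarrow> real ^ 'v ^ 'e" where
  "incidence_matrix src tgt =
     (\<chi> e v. if v = src e then 1 else if v = tgt e then -1 else 0)"

definition charpoly :: "real ^ 'n ^ 'n \<Rightarrow> real poly" where
  "charpoly M = det (\<chi> i j. (if i = j then [:0, 1:] else 0) - [:M $ i $ j:])"

text \<open>
  Real eigenvalues in increasing order, repeated according to algebraic multiplicity.  For a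
  symmetric matrix these are all the eigenvalues, so the list has length \<open>CARD('n)\<close>.
\<close>

definition eigenvalue_list :: "real ^ 'n ^ 'n \<Rightarrow> real list" where
  "eigenvalue_list M = sorted_list_of_multiset (proots (charpoly M))"

text \<open>List positions start at 0, so position 1 holds the second smallest eigenvalue.\<close>

definition algebraic_connectivity :: "real ^ 'v ^ 'e \<Rightarrow> real" where
  "algebraic_connectivity A = eigenvalue_list (transpose A ** A) ! 1"

definition dual_objective :: "real ^ 'v ^ 'e \<Rightarrow> real ^ 'v \<Rightarrow> real ^ 'e \<Rightarrow> real" where
  "dual_objective A c y = - ((A *v c) \<bullet> y) - 1 / 2 * (norm (transpose A *v y))\<^sup>2"

text \<open>
  The dual iterates along a given sequence \<open>es\<close> of selected edges.  For an incidence matrix of a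
  simple graph the objective is strictly concave along each \<open>axis e 1\<close>, so the line-search
  maximizer exists and is unique.
\<close>

primrec gossip_iterate ::
    "real ^ 'v ^ 'e \<Rightarrow> real ^ 'v \<Rightarrow> (nat \<Rightarrow> 'e) \<Rightarrow> nat \<Rightarrow> real ^ 'e" where
  "gossip_iterate A c es 0 = 0"
| "gossip_iterate A c es (Suc t) =
     gossip_iterate A c es t
       + arg_max (\<lambda>\<mu>. dual_objective A c (gossip_iterate A c es t + \<mu> *\<^sub>R axis (es t) 1))
           (\<lambda>_. True) *\<^sub>R axis (es t) 1"

end

theory Submission
  imports Defs
begin

text \<open>
  The dual objective is a concave quadratic whose gradient at \<open>y\<close> is \<open>- A x\<close> with the primal
  point \<open>x = c + A\<^sup>T y\<close>.  At a maximizer \<open>y*\<close> the gradient vanishes, so the second-order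
  expansion around \<open>y*\<close> is exact and the dual gap is \<open>D(y*) - D(y) = 1/2 \<parallel>z\<parallel>\<^sup>2\<close> with
  \<open>z = A\<^sup>T (y - y*)\<close>, while \<open>A x = A z\<close>.

  Every row of an incidence matrix has squared norm 2, so an exact line search along the
  coordinate \<open>e\<close> raises \<open>D\<close> by \<open>(A x)\<^sub>e\<^sup>2 / 4\<close>.  Averaged over all \<open>m\<close> edges this is
  \<open>\<parallel>A z\<parallel>\<^sup>2 / (4 m)\<close>.  The vector \<open>z\<close> lies in the range of \<open>A\<^sup>T\<close>, hence is orthogonal to the
  kernel of \<open>A\<close>, which for a connected graph consists of the constant vectors.  There the
  Rayleigh quotient of \<open>A\<^sup>T A\<close> is at least the algebraic connectivity
  (\<open>algebraic_connectivity_le_rayleigh\<close>), so the mean gain is at least \<open>\<alpha> / (2 m)\<close> times the gap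
  (\<open>expected_dual_gap_contraction\<close>).

  The Rayleigh bound holds for the following reason.  By compactness the Rayleigh quotient
  attains a minimum \<open>\<mu>\<close> on the complement of the kernel, and the minimizer is an eigenvector.
  Since the kernel is spanned by one vector, \<open>\<mu> > 0\<close>; so 0 and \<open>\<mu>\<close> are two different roots of
  the characteristic polynomial, and its second smallest root is at most \<open>\<mu>\<close>.

  Finally, the iterate \<open>y\<^sup>t\<close> is a function of the edges chosen before time \<open>t\<close> and is therefore
  independent of the edge chosen at time \<open>t\<close>.  This lets the average over the edges be taken under
  the expectation (\<open>expectation_uniform_step\<close>), and the expected gap shrinks by the same
  factor in every step.
\<close>

section \<open>Quadratic functions and eigenvalues\<close>

text \<open>
  The first-order condition for a minimum at 0 of a one-variable quadratic.  It is used both for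
  minimizers of the Rayleigh quotient and for maximizers of the dual objective.
\<close>

lemma linear_coefficient_eq_0_if_quadratic_nonneg:
  fixes a b :: real
  assumes "\<And>t. 0 \<le> t * b + t\<^sup>2 * a"
  shows "b = 0"
proof -
  define s where "s = 1 / (\<bar>a\<bar> + 1)"
  have s: "s > 0" "s * a < 1"
    by (auto simp: s_def divide_simps)
  \<comment> \<open>A step against the slope, so short that the linear term dominates the quadratic one.\<close>
  have "0 \<le> (- s * b) * b + (- s * b)\<^sup>2 * a"
    by (rule assms)
  also have "\<dots> = s * b\<^sup>2 * (s * a - 1)"
    by (simp add: power2_eq_square algebra_simps)
  finally show ?thesis
    using s by (simp add: zero_le_mult_iff mult_le_0_iff)
qed

lemma poly_charpoly: "poly (charpoly M) x = det (mat x - M)"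
  unfolding charpoly_def det_def poly_sum poly_mult poly_prod mat_def
  by (intro sum.cong refl arg_cong2[where f = "(*)"] prod.cong) auto

lemma poly_charpoly_eq_0_iff:
  "poly (charpoly M) x = 0 \<longleftrightarrow> (\<exists>v. v \<noteq> 0 \<and> M *v v = x *\<^sub>R v)"
proof -
  have "(mat x - M) *v v = x *\<^sub>R v - M *v v" for v
    by (simp add: vec_eq_iff matrix_vector_mult_def mat_def sum_subtractf left_diff_distrib
        if_distrib[where f = "\<lambda>a. a * _"] cong: if_cong)
  then have "(mat x - M) *v v = 0 \<longleftrightarrow> M *v v = x *\<^sub>R v" for v
    by auto
  then have "(\<exists>v. v \<noteq> 0 \<and> M *v v = x *\<^sub>R v) \<longleftrightarrow> \<not> (\<forall>v. (mat x - M) *v v = 0 \<longrightarrow> v = 0)"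
    by blast
  also have "\<dots> \<longleftrightarrow> det (mat x - M) = 0"
    by (metis invertible_det_nz invertible_left_inverse matrix_left_invertible_ker)
  finally show ?thesis
    by (simp add: poly_charpoly)
qed

text \<open>
  Two different roots occupy two different positions of the sorted list, so one of them stands at
  position 1 or later; as both are at most \<open>b\<close>, so is the entry at position 1.
\<close>

lemma second_root_le:
  fixes p :: "real poly"
  assumes "p \<noteq> 0" "poly p a = 0" "poly p b = 0" "a < b"
  shows "sorted_list_of_multiset (proots p) ! 1 \<le> b"
proof -
  define xs where "xs = sorted_list_of_multiset (proots p)"
  have "a \<in> set xs" "b \<in> set xs" and sorted: "sorted xs"
    using assms by (auto simp: xs_def)
  then obtain i j where ij: "i < length xs" "xs ! i = a" "j < length xs" "xs ! j = b"
    by (meson in_set_conv_nth)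
  show ?thesis
  proof (cases "j = 0")
    case True
    then have "1 \<le> i"
      using ij assms(4) by (cases i) auto
    then have "xs ! 1 \<le> a"
      using ij sorted sorted_nth_mono by blast
    then show ?thesis
      using assms(4) by (simp add: xs_def)
  next
    case False
    then have "xs ! 1 \<le> xs ! j"
      using ij sorted by (intro sorted_nth_mono) auto
    then show ?thesis
      using ij by (simp add: xs_def)
  qed
qed

lemma inner_gram: "((transpose A ** A) *v v) \<bullet> w = (A *v v) \<bullet> (A *v (w :: real ^ 'n))"
  for A :: "real ^ 'n ^ 'm"
  by (metis dot_lmul_matrix matrix_vector_mul_assoc transpose_matrix_vector)

text \<open>
  A Gram matrix is positive semidefinite, so -1 is not one of its eigenvalues.  A nonzero
  characteristic polynomial is needed because \<open>proots 0\<close> is empty by convention, although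
  every number is a root of 0.
\<close>

lemma charpoly_gram_nonzero: "charpoly (transpose A ** A) \<noteq> 0"
  for A :: "real ^ 'n ^ 'm"
proof
  assume "charpoly (transpose A ** A) = 0"
  then have "poly (charpoly (transpose A ** A)) (-1) = 0"
    by simp
  then obtain v where v: "v \<noteq> 0" "(transpose A ** A) *v v = (-1) *\<^sub>R v"
    unfolding poly_charpoly_eq_0_iff by blast
  have "0 \<le> (A *v v) \<bullet> (A *v v)"
    by simp
  also have "\<dots> = - (v \<bullet> v)"
    using v by (simp flip: inner_gram)
  finally show False
    using v(1) inner_gt_zero_iff[of v] by linarith
qed

text \<open>
  Perturbing the minimizer \<open>v\<close> within the complement of \<open>u\<close> gives the eigenvalue equation tested
  against that complement.  Testing against \<open>u\<close> itself gives 0 on both sides, because \<open>u\<close> is in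
  the kernel of \<open>A\<close>.
\<close>

lemma rayleigh_minimizer_is_eigenvector:
  fixes A :: "real ^ 'n ^ 'm"
  assumes u: "A *v u = 0" and v: "u \<bullet> v = 0"
    and \<mu>: "(A *v v) \<bullet> (A *v v) = \<mu> * (v \<bullet> v)"
    and min: "\<And>w. u \<bullet> w = 0 \<Longrightarrow> \<mu> * (w \<bullet> w) \<le> (A *v w) \<bullet> (A *v w)"
  shows "(transpose A ** A) *v v = \<mu> *\<^sub>R v"
proof -
  have perp: "(A *v v) \<bullet> (A *v w) = \<mu> * (v \<bullet> w)" if w: "u \<bullet> w = 0" for w
  proof -
    have "0 \<le> t * (2 * ((A *v v) \<bullet> (A *v w) - \<mu> * (v \<bullet> w)))
        + t\<^sup>2 * ((A *v w) \<bullet> (A *v w) - \<mu> * (w \<bullet> w))" for t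
    proof -
      have "u \<bullet> (v + t *\<^sub>R w) = 0"
        using v w by (simp add: inner_simps)
      from min[OF this] show ?thesis
        using \<mu> by (simp add: matrix_vector_right_distrib matrix_vector_mult_scaleR inner_simps
            inner_commute power2_eq_square algebra_simps)
    qed
    then show ?thesis
      using linear_coefficient_eq_0_if_quadratic_nonneg by fastforce
  qed
  \<comment> \<open>A general \<open>w\<close> is reduced to the complement by subtracting its projection onto \<open>u\<close>.\<close>
  have "((transpose A ** A) *v v) \<bullet> w = (\<mu> *\<^sub>R v) \<bullet> w" for w
  proof -
    define r where "r = (u \<bullet> w) / (u \<bullet> u)"
    have "u \<bullet> (w - r *\<^sub>R u) = 0"
      by (simp add: r_def inner_simps)
    from perp[OF this] show ?thesis
      unfolding inner_gram using u v
      by (simp add: matrix_vector_mult_diff_distrib matrix_vector_mult_scaleR inner_diff_right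
          inner_commute[of v u])
  qed
  then show ?thesis
    using vector_eq_rdot by blast
qed

text \<open>
  The Courant-Fischer bound for the second smallest eigenvalue, in the case of a one-dimensional
  kernel: the least value \<open>\<mu>\<close> of the Rayleigh quotient on the complement of the kernel is a nonzero
  eigenvalue, so together with the eigenvalue 0 it bounds the second smallest one.
\<close>

lemma algebraic_connectivity_le_rayleigh:
  fixes A :: "real ^ 'n ^ 'm"
  assumes ker: "\<And>w. A *v w = 0 \<longleftrightarrow> w \<in> span {u}" and u: "u \<noteq> 0" and z: "u \<bullet> z = 0"
  shows "algebraic_connectivity A * (z \<bullet> z) \<le> (A *v z) \<bullet> (A *v z)"
proof (cases "z = 0")
  case False
  define q where "q = (\<lambda>w. (A *v w) \<bullet> (A *v w))"
  define S where "S = sphere 0 1 \<inter> {w. u \<bullet> w = 0}"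
  have q_scale: "q (r *\<^sub>R w) = r\<^sup>2 * q w" for r w
    by (simp add: q_def matrix_vector_mult_scaleR power2_eq_square)
  have normalized: "w /\<^sub>R norm w \<in> S" if "w \<noteq> 0" "u \<bullet> w = 0" for w
    using that by (simp add: S_def)
  have nonempty: "S \<noteq> {}"
    using normalized[OF False z] by blast
  have compact: "compact S"
    unfolding S_def by (intro compact_Int_closed closed_hyperplane compact_sphere)
  have continuous: "continuous_on S q"
    unfolding q_def by (intro continuous_intros matrix_vector_mult_linear_continuous_on)
  obtain v where v: "v \<in> S" and v_min: "\<And>w. w \<in> S \<Longrightarrow> q v \<le> q w"
    using continuous_attains_inf[OF compact nonempty continuous] by metis
  define \<mu> where "\<mu> = q v"
  have vv: "v \<bullet> v = 1" "u \<bullet> v = 0" "v \<noteq> 0"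
    using v by (auto simp: S_def norm_eq_1)
  have rayleigh: "\<mu> * (w \<bullet> w) \<le> q w" if "u \<bullet> w = 0" for w
  proof (cases "w = 0")
    case False
    have "\<mu> \<le> q (w /\<^sub>R norm w)"
      unfolding \<mu>_def by (intro v_min normalized False that)
    then show ?thesis
      using False by (simp add: q_scale field_simps flip: power2_norm_eq_inner)
  qed (simp add: q_def)
  have Au: "A *v u = 0"
    by (simp add: ker span_base)
  have "(transpose A ** A) *v v = \<mu> *\<^sub>R v"
    by (rule rayleigh_minimizer_is_eigenvector[OF Au])
      (use rayleigh vv in \<open>auto simp: \<mu>_def q_def\<close>)
  then have root_\<mu>: "poly (charpoly (transpose A ** A)) \<mu> = 0"
    using vv(3) by (auto simp: poly_charpoly_eq_0_iff)
  have "(transpose A ** A) *v u = 0 *\<^sub>R u"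
    using Au by (simp flip: matrix_vector_mul_assoc)
  then have root_0: "poly (charpoly (transpose A ** A)) 0 = 0"
    using u poly_charpoly_eq_0_iff by blast
  have "A *v v \<noteq> 0"
    using vv u by (auto simp: ker span_singleton)
  then have "0 < \<mu>"
    by (simp add: \<mu>_def q_def)
  then have "algebraic_connectivity A \<le> \<mu>"
    unfolding algebraic_connectivity_def eigenvalue_list_def
    by (intro second_root_le[OF charpoly_gram_nonzero root_0 root_\<mu>])
  then have "algebraic_connectivity A * (z \<bullet> z) \<le> \<mu> * (z \<bullet> z)"
    by (intro mult_right_mono) auto
  also have "\<dots> \<le> (A *v z) \<bullet> (A *v z)"
    using rayleigh[OF z] by (simp add: q_def)
  finally show ?thesis .
qed simp

section \<open>Incidence matrices of connected graphs\<close>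

lemma incidence_matrix_row:
  assumes "src e \<noteq> tgt e"
  shows "incidence_matrix src tgt $ e = axis (src e) 1 - axis (tgt e) 1"
  using assms by (auto simp: incidence_matrix_def vec_eq_iff axis_def)

lemma edge_orientation_no_loop:
  assumes "simple_graph E" "edge_orientation E src tgt"
  shows "src e \<noteq> tgt e"
proof
  assume "src e = tgt e"
  then have "card {src e, tgt e} = 1"
    by simp
  moreover have "{src e, tgt e} \<in> E"
    using assms(2) by (auto simp: edge_orientation_def dest: bij_betwE)
  ultimately show False
    using assms(1) by (simp add: simple_graph_def)
qed

text \<open>
  \<open>A z\<close> lists the differences of \<open>z\<close> along the edges; if they all vanish, then \<open>z\<close> is constant along
  paths.
\<close>

lemma incidence_matrix_kernel:
  assumes "simple_graph E" "connected_graph E" "edge_orientation E src tgt"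
  shows "incidence_matrix src tgt *v z = 0 \<longleftrightarrow> z \<in> span {1}"
proof -
  have comp: "(incidence_matrix src tgt *v z) $ e = z $ src e - z $ tgt e" for z e
    by (simp add: matrix_vector_mul_component inner_simps inner_axis' 
        incidence_matrix_row edge_orientation_no_loop[OF assms(1,3)])
  show ?thesis
  proof
    assume *: "incidence_matrix src tgt *v z = 0"
    have edge: "z $ src e = z $ tgt e" for e
      using comp[of z e] * by simp
    have adj: "z $ a = z $ b" if ab: "{a, b} \<in> E" for a b
    proof -
      obtain e where "{src e, tgt e} = {a, b}"
        using assms(3) ab unfolding edge_orientation_def bij_betw_def by blast
      then show ?thesis
        using edge[of e] unfolding doubleton_eq_iff by metis
    qed
    have const: "z $ a = z $ b" for a b
    proof -
      have "(a, b) \<in> {(a, b). {a, b} \<in> E}\<^sup>*"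
        using assms(2) by (simp add: connected_graph_def)
      then show ?thesis
      proof (induction rule: rtrancl_induct)
        case (step b d)
        then show ?case
          using adj[of b d] by simp
      qed simp
    qed
    have "z = (z $ undefined) *\<^sub>R 1"
      unfolding vec_eq_iff using const by simp
    then show "z \<in> span {1}"
      by (auto simp: span_singleton)
  next
    assume "z \<in> span {1}"
    then show "incidence_matrix src tgt *v z = 0"
      by (auto simp: vec_eq_iff comp span_singleton)
  qed
qed

section \<open>The dual objective and exact line search\<close>

text \<open>The exact second-order Taylor expansion of the dual objective.\<close>

lemma dual_objective_add:
  "dual_objective A c (y + w) =
     dual_objective A c y - (A *v (c + transpose A *v y)) \<bullet> w - 1 / 2 * (norm (transpose A *v w))\<^sup>2"
proof -
  have "(A *v (y v* A)) \<bullet> w = (y v* A) \<bullet> (w v* A)"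
    by (metis dot_lmul_matrix inner_commute)
  then show ?thesis
    by (simp add: dual_objective_def vector_matrix_left_distrib matrix_vector_right_distrib
        power2_norm_eq_inner inner_simps inner_commute field_simps)
qed

lemma dual_objective_axis:
  "dual_objective A c (y + \<mu> *\<^sub>R axis e 1) =
     dual_objective A c y - \<mu> * (A *v (c + transpose A *v y)) $ e - \<mu>\<^sup>2 / 2 * (norm (A $ e))\<^sup>2"
proof -
  have "transpose A *v axis e 1 = A $ e"
    by (simp add: matrix_vector_mul_component vec_eq_iff transpose_def matrix_vector_mult_basis column_def del: transpose_matrix_vector)
  then have "transpose A *v (\<mu> *\<^sub>R axis e 1) = \<mu> *\<^sub>R A $ e"
    by (simp only: matrix_vector_mult_scaleR)
  then show ?thesis
    by (simp add: dual_objective_add inner_axis power_mult_distrib del: transpose_matrix_vector)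
qed

text \<open>
  The body of the recursion for the dual iterates, isolated so that it can be studied at an
  arbitrary point \<open>y\<close> and for an arbitrary edge.
\<close>

definition line_search_step :: "real ^ 'v ^ 'e \<Rightarrow> real ^ 'v \<Rightarrow> real ^ 'e \<Rightarrow> 'e \<Rightarrow> real ^ 'e" where
  "line_search_step A c y e =
     y + arg_max (\<lambda>\<mu>. dual_objective A c (y + \<mu> *\<^sub>R axis e 1)) (\<lambda>_. True) *\<^sub>R axis e 1"

text \<open>
  Completing the square turns the restriction to the line into a downward parabola with vertex at
  \<open>\<mu> = - q\<close>.  The step length is an \<open>arg_max\<close>, an unspecified maximizer, which enters only through
  the value that it attains.
\<close>

lemma dual_objective_line_search_step:
  assumes "A $ e \<noteq> 0"
  shows "dual_objective A c (line_search_step A c y e) =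
    dual_objective A c y + ((A *v (c + transpose A *v y)) $ e)\<^sup>2 / (2 * (norm (A $ e))\<^sup>2)"
proof -
  define g where "g = (A *v (c + transpose A *v y)) $ e"
  define s where "s = (norm (A $ e))\<^sup>2"
  define q where "q = g / s"
  have s: "s > 0" and g: "g = q * s"
    using assms by (simp_all add: s_def q_def)
  have D: "dual_objective A c (y + \<mu> *\<^sub>R axis e 1) =
      dual_objective A c y + q\<^sup>2 * s / 2 - s / 2 * (\<mu> + q)\<^sup>2" for \<mu>
    unfolding dual_objective_axis g_def[symmetric] s_def[symmetric] g
    by (simp add: power2_eq_square algebra_simps)
  have "dual_objective A c (line_search_step A c y e) =
      dual_objective A c (y + (- q) *\<^sub>R axis e 1)"
    unfolding line_search_step_def
  proof (rule arg_max_equality)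
    show "dual_objective A c (y + \<mu> *\<^sub>R axis e 1)
        \<le> dual_objective A c (y + (- q) *\<^sub>R axis e 1)" for \<mu>
      unfolding D using s by simp
  qed simp
  also have "\<dots> = dual_objective A c y + q\<^sup>2 * s / 2"
    unfolding D by simp
  also have "q\<^sup>2 * s / 2 = g\<^sup>2 / (2 * s)"
    using s by (simp add: g power2_eq_square)
  finally show ?thesis
    by (simp only: g_def s_def)
qed

lemma dual_maximizer_stationary:
  assumes "is_arg_max (dual_objective A c) (\<lambda>_. True) ystar"
  shows "A *v (c + transpose A *v ystar) = 0"
proof -
  have "- ((A *v (c + transpose A *v ystar)) $ e) = 0" for e
  proof (rule linear_coefficient_eq_0_if_quadratic_nonneg)
    fix \<mu> :: real
    have "dual_objective A c (ystar + (- \<mu>) *\<^sub>R axis e 1) \<le> dual_objective A c ystar"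
      using assms by (simp add: is_arg_max_linorder)
    then show "0 \<le> \<mu> * - ((A *v (c + transpose A *v ystar)) $ e) + \<mu>\<^sup>2 * ((norm (A $ e))\<^sup>2 / 2)"
      unfolding dual_objective_axis by simp
  qed
  then show ?thesis
    by (simp add: vec_eq_iff)
qed

text \<open>
  In the expansion around a maximizer the linear term is zero, which leaves only the quadratic one.
\<close>

lemma dual_gap_eq:
  assumes "is_arg_max (dual_objective A c) (\<lambda>_. True) ystar"
  shows "dual_objective A c ystar - dual_objective A c y =
    1 / 2 * (norm (transpose A *v (y - ystar)))\<^sup>2"
  using dual_objective_add[of A c ystar "y - ystar"] dual_maximizer_stationary[OF assms]
  by (simp del: transpose_matrix_vector)

text \<open>
  One step of uniform edge selection, written as a sum over the edges so that no probability space
  is involved: the gains \<open>(A z)\<^sub>e\<^sup>2 / 4\<close> add up to \<open>\<parallel>A z\<parallel>\<^sup>2 / 4\<close>, which the Rayleigh bound compares with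
  the gap \<open>\<parallel>z\<parallel>\<^sup>2 / 2\<close>.
\<close>

lemma expected_dual_gap_contraction:
  fixes A :: "real ^ 'v ^ 'e"
  assumes opt: "is_arg_max (dual_objective A c) (\<lambda>_. True) ystar"
    and ker: "\<And>w. A *v w = 0 \<longleftrightarrow> w \<in> span {u}" and u: "u \<noteq> 0"
    and rows: "\<And>e. (norm (A $ e))\<^sup>2 = 2"
  shows "(\<Sum>e\<in>UNIV. dual_objective A c ystar - dual_objective A c (line_search_step A c y e))
    \<le> (real CARD('e) - algebraic_connectivity A / 2)
        * (dual_objective A c ystar - dual_objective A c y)"
proof -
  define g where "g = A *v (c + transpose A *v y)"
  define z where "z = transpose A *v (y - ystar)"
  have nz: "A $ e \<noteq> 0" for e
    using rows[of e] by auto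
  have gap: "dual_objective A c ystar - dual_objective A c y = 1 / 2 * (z \<bullet> z)"
    by (simp only: dual_gap_eq[OF opt] z_def power2_norm_eq_inner)
  have Au: "A *v u = 0"
    by (simp add: ker span_base)
  have "u \<bullet> z = (A *v u) \<bullet> (y - ystar)"
    by (simp add: z_def) (metis dot_lmul_matrix inner_commute)
  then have uz: "u \<bullet> z = 0"
    by (simp add: Au)
  have "g = A *v ((c + transpose A *v y) - (c + transpose A *v ystar))"
    unfolding g_def matrix_vector_mult_diff_distrib dual_maximizer_stationary[OF opt] by simp
  also have "(c + transpose A *v y) - (c + transpose A *v ystar) = z"
    unfolding z_def matrix_vector_mult_diff_distrib by simp
  finally have g: "g = A *v z" .
  have "(\<Sum>e\<in>UNIV. dual_objective A c ystar - dual_objective A c (line_search_step A c y e))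
      = (\<Sum>e\<in>UNIV. 1 / 2 * (z \<bullet> z) - (g $ e)\<^sup>2 / 4)"
    unfolding dual_objective_line_search_step[OF nz] rows g_def[symmetric] gap[symmetric]
    by (simp add: diff_diff_eq)
  also have "\<dots> = real CARD('e) * (1 / 2 * (z \<bullet> z)) - (g \<bullet> g) / 4"
    by (simp add: sum_subtractf inner_vec_def power2_eq_square sum_divide_distrib)
  also have "\<dots> \<le> (real CARD('e) - algebraic_connectivity A / 2) * (1 / 2 * (z \<bullet> z))"
    using algebraic_connectivity_le_rayleigh[OF ker u uz] by (simp add: g algebra_simps)
  finally show ?thesis
    by (simp only: gap)
qed

section \<open>Averaging over a fresh independent choice\<close>

context prob_space
begin

text \<open>
  A function of the first \<open>k\<close> choices is a function on a finite set of histories, so it is bounded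
  and measurable whatever \<open>h\<close> is; and it is independent of choice number \<open>k\<close>.
\<close>

lemma
  fixes X :: "nat \<Rightarrow> 'a \<Rightarrow> 'e::finite" and h :: "(nat \<Rightarrow> 'e) \<Rightarrow> real"
  assumes indep: "indep_vars (\<lambda>_. count_space UNIV) X UNIV"
    and past: "\<And>f g. (\<And>s. s < k \<Longrightarrow> f s = g s) \<Longrightarrow> h f = h g"
  shows integrable_past: "integrable M (\<lambda>\<omega>. h (\<lambda>s. X s \<omega>))"
    and integrable_fresh_times_past: 
      "integrable M (\<lambda>\<omega>. indicator {e} (X k \<omega>) * h (\<lambda>s. X s \<omega>))"
    and expectation_fresh_times_past: 
      "expectation (\<lambda>\<omega>. indicator {e} (X k \<omega>) * h (\<lambda>s. X s \<omega>))
         = prob {\<omega> \<in> space M. X k \<omega> = e} * expectation (\<lambda>\<omega>. h (\<lambda>s. X s \<omega>))"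
proof -
  have X [measurable]: "X t \<in> measurable M (count_space UNIV)" for t
    using indep by (simp add: indep_vars_def)
  define P :: "nat set \<Rightarrow> (nat \<Rightarrow> 'e) measure"
    where "P I = PiM I (\<lambda>_. count_space UNIV)" for I
  have P: "P I = count_space (Pi\<^sub>E I (\<lambda>_. UNIV))" if "finite I" for I
    unfolding P_def using that by (intro count_space_PiM_finite) auto
  have restr: "(\<lambda>\<omega>. restrict (\<lambda>i. X i \<omega>) I) \<in> measurable M (P I)" for I
    unfolding P_def by measurable
  have h_restr: "h (restrict f {..<k}) = h f" for f
    by (rule past) simp
  have h_meas: "h \<in> borel_measurable (P {..<k})"
    by (simp add: P)
  have past_meas: "(\<lambda>\<omega>. h (\<lambda>s. X s \<omega>)) \<in> borel_measurable M"
    using measurable_compose[OF restr h_meas] by (simp add: h_restr)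
  have "finite (h ` (Pi\<^sub>E {..<k} (\<lambda>_. UNIV)))"
    by (intro finite_imageI finite_PiE) auto
  then obtain B where B: "\<And>f. f \<in> Pi\<^sub>E {..<k} (\<lambda>_. UNIV) \<Longrightarrow> norm (h f) \<le> B"
    using finite_imp_bounded bounded_iff by (metis imageI)
  have "norm (h (\<lambda>s. X s \<omega>)) \<le> B" for \<omega>
    using B[of "restrict (\<lambda>s. X s \<omega>) {..<k}"] by (simp add: h_restr)
  then show int_past: "integrable M (\<lambda>\<omega>. h (\<lambda>s. X s \<omega>))"
    by (intro integrable_const_bound[where B = B] past_meas) auto
  have ind_meas: "(\<lambda>f. indicator {e} (f k)) \<in> borel_measurable (P {k})"
    by (simp add: P)
  have "indep_var (P {k}) (\<lambda>\<omega>. restrict (\<lambda>i. X i \<omega>) {k})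
      (P {..<k}) (\<lambda>\<omega>. restrict (\<lambda>i. X i \<omega>) {..<k})"
    unfolding P_def by (rule indep_var_restrict[OF indep]) auto
  from indep_var_compose[OF this ind_meas h_meas]
  have indep2: "indep_var borel (\<lambda>\<omega>. indicator {e} (X k \<omega>) :: real) borel (\<lambda>\<omega>. h (\<lambda>s. X s \<omega>))"
    by (simp add: comp_def h_restr)
  have int_fresh: "integrable M (\<lambda>\<omega>. indicator {e} (X k \<omega>) :: real)"
    by (intro integrable_const_bound[where B = 1]) (auto simp: indicator_def)
  show "integrable M (\<lambda>\<omega>. indicator {e} (X k \<omega>) * h (\<lambda>s. X s \<omega>))"
    by (rule indep_var_integrable[OF indep2 int_fresh int_past])
  have "expectation (\<lambda>\<omega>. indicator {e} (X k \<omega>) :: real)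
      = expectation (indicator {\<omega> \<in> space M. X k \<omega> = e})"
    by (intro Bochner_Integration.integral_cong) (auto simp: indicator_def)
  also have "\<dots> = prob {\<omega> \<in> space M. X k \<omega> = e}"
    by simp
  finally show "expectation (\<lambda>\<omega>. indicator {e} (X k \<omega>) * h (\<lambda>s. X s \<omega>))
      = prob {\<omega> \<in> space M. X k \<omega> = e} * expectation (\<lambda>\<omega>. h (\<lambda>s. X s \<omega>))"
    by (simp add: indep_var_lebesgue_integral[OF indep2 int_fresh int_past])
qed

text \<open>
  Conditioning on the past, done by hand: after splitting according to the value of the fresh
  choice, each summand is a product of independent factors.
\<close>

lemma expectation_uniform_step:
  fixes X :: "nat \<Rightarrow> 'a \<Rightarrow> 'e::finite" and h :: "(nat \<Rightarrow> 'e) \<Rightarrow> 'e \<Rightarrow> real"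
  assumes indep: "indep_vars (\<lambda>_. count_space UNIV) X UNIV"
    and past: "\<And>f g e. (\<And>s. s < k \<Longrightarrow> f s = g s) \<Longrightarrow> h f e = h g e"
    and unif: "\<And>e. prob {\<omega> \<in> space M. X k \<omega> = e} = p"
  shows "expectation (\<lambda>\<omega>. h (\<lambda>s. X s \<omega>) (X k \<omega>))
    = p * expectation (\<lambda>\<omega>. \<Sum>e\<in>UNIV. h (\<lambda>s. X s \<omega>) e)"
proof -
  have "expectation (\<lambda>\<omega>. h (\<lambda>s. X s \<omega>) (X k \<omega>))
      = expectation (\<lambda>\<omega>. \<Sum>e\<in>UNIV. indicator {e} (X k \<omega>) * h (\<lambda>s. X s \<omega>) e)"
    by (simp add: indicator_def if_distrib[where f = "\<lambda>a. a * _"] cong: if_cong)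
  also have "\<dots> = (\<Sum>e\<in>UNIV. expectation (\<lambda>\<omega>. indicator {e} (X k \<omega>) * h (\<lambda>s. X s \<omega>) e))"
    by (intro Bochner_Integration.integral_sum integrable_fresh_times_past[OF indep] past)
  also have "\<dots> = (\<Sum>e\<in>UNIV. p * expectation (\<lambda>\<omega>. h (\<lambda>s. X s \<omega>) e))"
    by (intro sum.cong refl, subst expectation_fresh_times_past[OF indep past]) (auto simp: unif)
  also have "\<dots> = p * expectation (\<lambda>\<omega>. \<Sum>e\<in>UNIV. h (\<lambda>s. X s \<omega>) e)"
    by (subst Bochner_Integration.integral_sum)
      (auto simp: sum_distrib_left intro!: integrable_past[OF indep] past)
  finally show ?thesis .
qed

end

section \<open>Convergence of randomized gossip\<close>

lemma gossip_iterate_Suc_eq_line_search_step: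
  "gossip_iterate A c es (Suc t) = line_search_step A c (gossip_iterate A c es t) (es t)"
  by (simp add: line_search_step_def)

lemma gossip_iterate_past:
  assumes "\<And>s. s < t \<Longrightarrow> es s = es' s"
  shows "gossip_iterate A c es t = gossip_iterate A c es' t"
  using assms by (induction t) auto

theorem theorem5:
  fixes E :: "'v::finite set set"
    and src tgt :: "'e::finite \<Rightarrow> 'v"
    and A :: "real ^ 'v ^ 'e"
    and c :: "real ^ 'v"
    and ystar :: "real ^ 'e"
    and M :: "'a measure"
    and edge :: "nat \<Rightarrow> 'a \<Rightarrow> 'e"
    and y :: "nat \<Rightarrow> 'a \<Rightarrow> real ^ 'e"
    and k :: nat
  assumes "CARD('v) \<ge> 2"
    and "simple_graph E"
    and "connected_graph E"
    and "edge_orientation E src tgt"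
    and A_def: "A = incidence_matrix src tgt"
    and "is_arg_max (dual_objective A c) (\<lambda>_. True) ystar"
    and "prob_space M"
    and "prob_space.indep_vars M (\<lambda>_. count_space UNIV) edge UNIV"
    and "\<And>t e. measure M {\<omega> \<in> space M. edge t \<omega> = e} = 1 / real (card E)"
    and y_def: "\<And>t \<omega>. y t \<omega> = gossip_iterate A c (\<lambda>s. edge s \<omega>) t"
  shows "prob_space.expectation M (\<lambda>\<omega>. dual_objective A c ystar - dual_objective A c (y k \<omega>))
           \<le> (1 - algebraic_connectivity A / (2 * real (card E))) ^ k
               * (dual_objective A c ystar - dual_objective A c 0)"
proof -
  interpret prob_space M
    by fact
  note graph = assms(2-4) and opt = assms(6) and indep = assms(8) and unif = assms(9)
  define gap where "gap = (\<lambda>y. dual_objective A c ystar - dual_objective A c y)"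
  define r where "r = 1 - algebraic_connectivity A / (2 * real (card E))"
  have card_E: "card E = CARD('e)"
    using graph(3) bij_betw_same_card unfolding edge_orientation_def by metis
  have loopfree: "src e \<noteq> tgt e" for e
    by (rule edge_orientation_no_loop[OF graph(1,3)])
  have rows: "(norm (A $ e))\<^sup>2 = 2" for e
    using loopfree[of e]
    by (simp add: A_def incidence_matrix_row power2_norm_eq_inner inner_simps inner_axis_axis)
  have ker: "A *v w = 0 \<longleftrightarrow> w \<in> span {1}" for w
    unfolding A_def by (rule incidence_matrix_kernel[OF graph])
  have one: "(1 :: real ^ 'v) \<noteq> 0"
    by (simp add: vec_eq_iff)
  have gap_nonneg: "0 \<le> gap w" for w
    using opt by (simp add: gap_def is_arg_max_linorder)
  have average: "(\<Sum>e\<in>UNIV. gap (line_search_step A c w e)) / real (card E) \<le> r * gap w" for w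
    using expected_dual_gap_contraction[OF opt ker one rows, of w]
    by (simp add: gap_def r_def card_E field_simps)
  define G where "G = (\<lambda>t. expectation (\<lambda>\<omega>. gap (y t \<omega>)))"
  have step: "G (Suc t) \<le> r * G t" for t
  proof -
    have past: "gossip_iterate A c f t = gossip_iterate A c g t"
      if "\<And>s. s < t \<Longrightarrow> f s = g s" for f g
      using that by (rule gossip_iterate_past)
    have integrable_y: "integrable M (\<lambda>\<omega>. F (y t \<omega>))" for F :: "real ^ 'e \<Rightarrow> real"
      unfolding y_def
      by (rule integrable_past[OF indep, where h = "\<lambda>f. F (gossip_iterate A c f t)"])
        (rule arg_cong[OF past])
    have "G (Suc t) = expectation (\<lambda>\<omega>. gap (line_search_step A c (y t \<omega>) (edge t \<omega>)))"
      unfolding G_def y_def gossip_iterate_Suc_eq_line_search_step ..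
    also have "\<dots> = 1 / real (card E)
        * expectation (\<lambda>\<omega>. \<Sum>e\<in>UNIV. gap (line_search_step A c (y t \<omega>) e))"
      unfolding y_def
      by (rule expectation_uniform_step[OF indep _ unif,
            where h = "\<lambda>f e. gap (line_search_step A c (gossip_iterate A c f t) e)"])
        (rule arg_cong[OF past])
    also have "\<dots> = expectation
        (\<lambda>\<omega>. (\<Sum>e\<in>UNIV. gap (line_search_step A c (y t \<omega>) e)) / real (card E))"
      by simp
    also have "\<dots> \<le> expectation (\<lambda>\<omega>. r * gap (y t \<omega>))"
      by (rule integral_mono[OF integrable_y integrable_y average])
    also have "\<dots> = r * G t"
      by (simp add: G_def)
    finally show ?thesis .
  qed
  have G0: "G 0 = gap 0"
    by (simp add: G_def y_def prob_space)
  have G_nonneg: "0 \<le> G t" for t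
    unfolding G_def by (simp add: gap_nonneg)
  \<comment> \<open>The induction multiplies the hypothesis by \<open>r\<close>.  A negative \<open>r\<close> would force a gap of zero at
    all times, since the gap is nonnegative and at most \<open>r\<close> times a nonnegative number.\<close>
  have "G k \<le> r ^ k * gap 0"
  proof (cases "0 \<le> r")
    case True
    show ?thesis
    proof (induction k)
      case (Suc t)
      have "G (Suc t) \<le> r * G t"
        by (rule step)
      also have "\<dots> \<le> r * (r ^ t * gap 0)"
        using Suc True by (intro mult_left_mono)
      finally show ?case
        by (simp add: mult_ac)
    qed (simp add: G0)
  next
    case False
    have G_0: "G t = 0" for t
      using step[of t] G_nonneg[of "Suc t"] G_nonneg[of t] False
      by (smt (verit) mult_neg_pos)
    show ?thesis
      using G_0[of k] G_0[of 0] by (simp add: G0)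
  qed
  then show ?thesis
    by (simp add: G_def gap_def r_def)
qed

end
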